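(* For every positive integer $n$, the statistic $\sigma\mapsto\mathrm{maj}(\sigma)-\mathrm{inv}(\sigma)$ on $S_n$ is $0$-mesic with respect to each of the following bijections $S_n\to S_n$: the Lehmer-code-to-major-code bijection $\mathcal{M}$, its inverse $\mathcal{M}^{-1}$, the Foata bijection $\mathcal{F}$, and its inverse $\mathcal{F}^{-1}$.
   Context: A statistic $f$ is $c$-mesic with respect to a bijection $\mathcal{X}$ of a finite set if its average over every orbit of $\mathcal{X}$ equals $c$. For $\sigma\in S_n$ in one-line notation, $\mathrm{inv}(\sigma)=\#\{i<j:\sigma_i>\sigma_j\}$ and $\mathrm{maj}(\sigma)=\sum_{i:\sigma_i>\sigma_{i+1}} i$. Lehmer code: $L(\sigma)_i=\#\{j>i:\sigma_j<\sigma_i\}$, $1\le i\le n$. Major code: for $1\le i\le n+1$ let $\mathrm{del}_i(\sigma)$ be the permutation obtained from $\sigma$ by deleting all entries smaller than $i$ and standardizing (so $\mathrm{del}_1(\sigma)=\sigma$ and $\mathrm{del}_{n+1}(\sigma)$ is empty with major index $0$); $M(\sigma)_i=\mathrm{maj}(\mathrm{del}_i(\sigma))-\mathrm{maj}(\mathrm{del}_{i+1}(\sigma))$. (E.g. $31542$ has major code $(3,3,1,1,0)$.) The map $\sigma\mapsto M(\sigma)$ is a bijection onto the same set of sequences as the Lehmer codes; $\mathcal{M}(\sigma)$ is the unique permutation $\tau$ with $M(\tau)=L(\sigma)$. Foata bijection $\mathcal{F}$: define $\mathcal{F}(\sigma_1)=\sigma_1$. If $\mathcal{F}(\sigma_1\cdots\sigma_i)=\tau_1\cdots\tau_i$,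 obtain $\mathcal{F}(\sigma_1\cdots\sigma_{i+1})$ as follows: place a vertical line to the left of $\tau_1$; if $\sigma_{i+1}>\tau_i$, place a vertical line to the right of each $\tau_k$ with $\sigma_{i+1}>\tau_k$; if $\sigma_{i+1}<\tau_i$, place a vertical line to the right of each $\tau_k$ with $\sigma_{i+1}<\tau_k$; within each block between vertical lines cyclically shift the entries one place to the right, and then append $\sigma_{i+1}$ at the end. $\mathcal{F}(\sigma)=\mathcal{F}(\sigma_1\cdots\sigma_n)$. (E.g. $\mathcal{F}(31542)=53412$.) *)

theory Defs
  imports Complex_Main "HOL-Combinatorics.Multiset_Permutations" "HOL-Combinatorics.Orbits"
begin

text \<open>
  A permutation of size \<open>n\<close> is its one-line notation, an element of
  \<^term>\<open>permutations_of_set {1..n}\<close>: entry \<open>i\<close> of the permutation (\<open>1 \<le> i \<le> n\<close>) is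
  list element \<open>i - 1\<close>.
\<close>

abbreviation perms :: "nat \<Rightarrow> nat list set" where
  "perms n \<equiv> permutations_of_set {1..n}"

text \<open>
  \<^const>\<open>orbit\<close> collects the forward iterates only; for a bijection of a finite set, as
  required here, this is the full orbit.
\<close>

definition mesic :: "real \<Rightarrow> ('a \<Rightarrow> real) \<Rightarrow> 'a set \<Rightarrow> ('a \<Rightarrow> 'a) \<Rightarrow> bool" where
  "mesic c f S X \<longleftrightarrow>
     finite S \<and> bij_betw X S S \<and>
     (\<forall>x\<in>S. (\<Sum>y\<in>orbit X x. f y) / real (card (orbit X x)) = c)"

definition inversions :: "nat list \<Rightarrow> nat" where
  "inversions \<sigma> = card {(i, j). i < j \<and> j < length \<sigma> \<and> \<sigma> ! i > \<sigma> ! j}"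

definition maj :: "nat list \<Rightarrow> nat" where
  "maj \<sigma> = \<Sum> {i. 1 \<le> i \<and> i < length \<sigma> \<and> \<sigma> ! (i - 1) > \<sigma> ! i}"

definition lehmer_code :: "nat list \<Rightarrow> nat list" where
  "lehmer_code \<sigma> =
     map (\<lambda>i. card {j. i < j \<and> j < length \<sigma> \<and> \<sigma> ! j < \<sigma> ! i}) [0..<length \<sigma>]"

definition standardize :: "nat list \<Rightarrow> nat list" where
  "standardize w = map (\<lambda>x. card {y \<in> set w. y \<le> x}) w"

definition del :: "nat \<Rightarrow> nat list \<Rightarrow> nat list" where
  "del i \<sigma> = standardize (filter (\<lambda>x. i \<le> x) \<sigma>)"

text \<open>Integer-valued, so that the differences of major indices are not truncated.\<close>

definition major_code :: "nat list \<Rightarrow> int list" where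
  "major_code \<sigma> =
     map (\<lambda>i. int (maj (del i \<sigma>)) - int (maj (del (i + 1) \<sigma>))) [1..<length \<sigma> + 1]"

definition lehmer_to_major :: "nat list \<Rightarrow> nat list" where
  "lehmer_to_major \<sigma> =
     (THE \<tau>. \<tau> \<in> perms (length \<sigma>) \<and> major_code \<tau> = map int (lehmer_code \<sigma>))"

text \<open>
  \<open>blocks P w\<close> cuts \<open>w\<close> to the right of each letter satisfying \<open>P\<close>; a trailing run of
  letters not satisfying \<open>P\<close> forms a last block.
\<close>

fun blocks :: "('a \<Rightarrow> bool) \<Rightarrow> 'a list \<Rightarrow> 'a list list" where
  "blocks P [] = []"
| "blocks P (x # xs) =
     (if P x then [x] # blocks P xs
      else (case blocks P xs of [] \<Rightarrow> [[x]] | b # bs \<Rightarrow> (x # b) # bs))"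

definition shift_right :: "'a list \<Rightarrow> 'a list" where
  "shift_right b = (if b = [] then [] else last b # butlast b)"

definition foata_step :: "nat list \<Rightarrow> nat \<Rightarrow> nat list" where
  "foata_step \<tau> a =
     concat (map shift_right (blocks (\<lambda>t. if a > last \<tau> then a > t else a < t) \<tau>)) @ [a]"

text \<open>The first step starts from the empty word, which has no blocks, and yields
  the one-letter word.\<close>

definition foata :: "nat list \<Rightarrow> nat list" where
  "foata \<sigma> = foldl foata_step [] \<sigma>"

end

theory Submission imports Defs begin

text \<open>
  Both bijections exchange the two statistics: \<open>inv \<sigma> = maj (\<M> \<sigma>)\<close>, because the entries of the
  Lehmer code of \<open>\<sigma>\<close> add up to \<open>inv \<sigma>\<close> and the entries of the major code of \<open>\<tau>\<close> telescope to
  \<open>maj \<tau>\<close>, and \<open>maj \<sigma> = inv (\<F> \<sigma>)\<close>, because appending a letter to a word changes \<open>maj\<close> exactly as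
  the corresponding Foata step changes \<open>inv\<close>. As a bijection permutes each of its orbits, the sums
  of \<open>maj\<close> and of \<open>inv\<close> over an orbit agree.

  Both codes are injective maps into a set with \<open>n!\<close> elements, hence bijective onto it. For the
  major code this rests on the fact that the possible insertions of a new smallest letter into a
  word raise \<open>maj\<close> by pairwise distinct amounts.
\<close>

section \<open>Orbits\<close>

text \<open>The orbit is closed under \<open>X\<close> by construction and lies in the finite set
  \<open>S\<close>, on which \<open>X\<close> is injective; an injective self-map of a finite set is
  onto.\<close>

lemma bij_betw_orbit:
  assumes "finite S" "bij_betw X S S" "x \<in> S"
  shows "bij_betw X (orbit X x) (orbit X x)"
proof -
  have sub: "y \<in> S" if "y \<in> orbit X x" for y
    using that assms(2,3) by induction (auto dest: bij_betwE)
  have fin: "finite (orbit X x)"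
    using sub assms(1) by (meson finite_subset subsetI)
  have inj: "inj_on X (orbit X x)"
    using sub assms(2) by (meson bij_betw_def inj_on_subset subsetI)
  have "X ` orbit X x \<subseteq> orbit X x"
    by (auto intro: orbit.step)
  with fin inj show ?thesis
    by (simp add: bij_betw_def endo_inj_surj)
qed

lemma mesic_diff_if_exchanged:
  assumes "finite S" "bij_betw X S S" "\<And>x. x \<in> S \<Longrightarrow> g (X x) = h x"
  shows "mesic 0 (\<lambda>x. g x - h x) S X"
  unfolding mesic_def
proof (intro conjI ballI)
  fix x assume x: "x \<in> S"
  have sub: "y \<in> S" if "y \<in> orbit X x" for y
    using that x assms(2) by induction (auto dest: bij_betwE)
  have "(\<Sum>y\<in>orbit X x. g y) = (\<Sum>y\<in>orbit X x. g (X y))"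
    by (rule sum.reindex_bij_betw[OF bij_betw_orbit[OF assms(1,2) x], symmetric])
  also have "\<dots> = (\<Sum>y\<in>orbit X x. h y)"
    by (rule sum.cong) (auto simp: sub assms(3))
  finally show "(\<Sum>y\<in>orbit X x. g y - h y) / real (card (orbit X x)) = 0"
    by (simp add: sum_subtractf)
qed (use assms in auto)

text \<open>Corrects the sign: the exchange lemmas yield inv - maj for the Foata map and for the
  inverse of \<open>lehmer_to_major\<close>.\<close>

lemma mesic_diff_commute:
  assumes "mesic 0 (\<lambda>x. g x - h x) S X"
  shows "mesic 0 (\<lambda>x. h x - g x) S X"
proof -
  have "(\<Sum>y\<in>A. h y - g y) = - (\<Sum>y\<in>A. g y - h y)" for A
    by (simp flip: sum_negf)
  with assms show ?thesis
    by (simp add: mesic_def del: sum_subtractf)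
qed

lemma mesic_inv_into_diff_if_exchanged:
  assumes "finite S" "bij_betw X S S" "\<And>x. x \<in> S \<Longrightarrow> g (X x) = h x"
  shows "mesic 0 (\<lambda>x. h x - g x) S (inv_into S X)"
proof (rule mesic_diff_if_exchanged)
  show "bij_betw (inv_into S X) S S"
    by (rule bij_betw_inv_into[OF assms(2)])
  fix x assume x: "x \<in> S"
  then have "inv_into S X x \<in> S" "X (inv_into S X x) = x"
    using assms(2) by (auto simp: bij_betw_def intro: inv_into_into f_inv_into_f)
  with assms(3) show "h (inv_into S X x) = g x"
    by metis
qed (rule assms(1))


section \<open>Inversions and the Lehmer code\<close>

lemma lehmer_code_Nil [simp]: "lehmer_code [] = []"
  by (simp add: lehmer_code_def)

text \<open>Replaces positions by letters, so that Lehmer codes and, through their sum, inversions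
  can be handled by induction on the word.\<close>

lemma lehmer_code_Cons [simp]:
  "lehmer_code (x # xs) = length (filter (\<lambda>y. y < x) xs) # lehmer_code xs"
proof -
  have 1: "{j. 0 < j \<and> j < Suc (length xs) \<and> (x # xs) ! j < x} = Suc ` {j. j < length xs \<and> xs ! j < x}"
    by (auto simp: image_iff gr0_conv_Suc)
  have 2: "{j. Suc i < j \<and> j < Suc (length xs) \<and> (x # xs) ! j < xs ! i}
      = Suc ` {j. i < j \<and> j < length xs \<and> xs ! j < xs ! i}" for i
    by (auto simp: image_iff Suc_less_eq2)
  show ?thesis
    unfolding lehmer_code_def
    by (simp add: map_upt_Suc 1 2 card_image length_filter_conv_card del: upt_Suc)
qed

lemma inversions_eq_sum_lehmer_code: "inversions \<sigma> = sum_list (lehmer_code \<sigma>)"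
proof -
  have "{(i, j). i < j \<and> j < length \<sigma> \<and> \<sigma> ! i > \<sigma> ! j}
      = (SIGMA i:{0..<length \<sigma>}. {j. i < j \<and> j < length \<sigma> \<and> \<sigma> ! j < \<sigma> ! i})"
    by auto
  then show ?thesis
    by (simp add: inversions_def lehmer_code_def sum_list_distinct_conv_sum_set)
qed

lemma inversions_Nil [simp]: "inversions [] = 0"
  by (simp add: inversions_eq_sum_lehmer_code)

lemma inversions_Cons [simp]:
  "inversions (x # xs) = length (filter (\<lambda>y. y < x) xs) + inversions xs"
  by (simp add: inversions_eq_sum_lehmer_code)

text \<open>The first entry is the rank of the first letter in the common letter set, and the rank
  determines the letter. Arbitrary letter sets keep the induction going, as the tail of a
  permutation need not use an initial segment.\<close>

lemma lehmer_code_inj: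
  assumes "distinct xs" "distinct ys" "set xs = set ys" "lehmer_code xs = lehmer_code ys"
  shows "xs = ys"
  using assms
proof (induction xs arbitrary: ys)
  case (Cons x xs)
  then obtain y ys' where ys: "ys = y # ys'"
    by (cases ys) auto
  let ?A = "set (x # xs)"
  have rank: "length (filter (\<lambda>b. b < z) zs) = card {b \<in> set (z # zs). b < z}"
    if "distinct (z # zs)" for z :: nat and zs
  proof -
    have "{b \<in> set (z # zs). b < z} = set (filter (\<lambda>b. b < z) zs)"
      by auto
    then show ?thesis
      using that by (simp only: distinct_card distinct_filter distinct.simps)
  qed
  have eq: "card {b \<in> ?A. b < x} = card {b \<in> ?A. b < y}"
    using rank[of x xs] rank[of y ys'] Cons.prems by (simp only: ys lehmer_code_Cons list.inject)
  have less: "card {b \<in> ?A. b < u} < card {b \<in> ?A. b < v}" if "u < v" "u \<in> ?A" for u v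
    by (rule psubset_card_mono) (use that in auto)
  have "y \<in> ?A"
    using Cons.prems(3) ys by auto
  have "x = y"
  proof (rule linorder_cases)
    assume "x < y"
    from less[OF this] eq show ?thesis
      by simp
  next
    assume "y < x"
    from less[OF this \<open>y \<in> ?A\<close>] eq show ?thesis
      by simp
  qed
  moreover have "xs = ys'"
  proof (rule Cons.IH)
    have "set xs = set (x # xs) - {x}" "set ys' = set (y # ys') - {y}"
      using Cons.prems(1,2) ys by auto
    then show "set xs = set ys'"
      using Cons.prems(3) \<open>x = y\<close> ys by metis
  qed (use Cons.prems ys in simp_all)
  ultimately show ?case
    by (simp add: ys)
qed simp

text \<open>The common range of both codes: entry \<open>i\<close>, counted from 0, is less than
  \<open>n - i\<close>. Splitting off the first entry makes the count n! a product.\<close>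

fun codes :: "nat \<Rightarrow> nat list set" where
  "codes 0 = {[]}"
| "codes (Suc n) = (\<lambda>(c, cs). c # cs) ` ({..n} \<times> codes n)"

lemma finite_codes: "finite (codes n)"
  by (induction n) auto

lemma card_codes: "card (codes n) = fact n"
proof (induction n)
  case (Suc n)
  have "inj_on (\<lambda>(c, cs). c # cs) ({..n} \<times> codes n)"
    by (auto simp: inj_on_def)
  with Suc show ?case
    by (simp add: card_image card_cartesian_product)
qed simp

lemma in_codesI:
  "length c = n \<Longrightarrow> (\<And>i. i < n \<Longrightarrow> c ! i < n - i) \<Longrightarrow> c \<in> codes n"
proof (induction n arbitrary: c)
  case (Suc n)
  then obtain x xs where c: "c = x # xs"
    by (cases c) auto
  have "xs \<in> codes n"
  proof (rule Suc.IH)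
    show "xs ! i < n - i" if "i < n" for i
      using Suc.prems(2)[of "Suc i"] that c by simp
  qed (use Suc.prems c in simp)
  moreover have "x \<le> n"
    using Suc.prems(2)[of 0] c by simp
  ultimately show ?case
    by (auto simp: c)
qed simp

lemma lehmer_code_in_codes: "lehmer_code \<sigma> \<in> codes (length \<sigma>)"
  by (induction \<sigma>) auto

text \<open>Both sets have n! elements, so surjectivity comes for free and no decoding map has to be
  constructed.\<close>

lemma bij_betw_perms_codes:
  assumes "inj_on f (perms n)" "f ` perms n \<subseteq> codes n"
  shows "bij_betw f (perms n) (codes n)"
proof -
  have "f ` perms n = codes n"
    by (rule card_subset_eq) (use assms in \<open>auto simp: finite_codes card_codes card_image\<close>)
  with assms(1) show ?thesis
    by (simp add: bij_betw_def)
qed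

lemma perms_length: "\<sigma> \<in> perms n \<Longrightarrow> length \<sigma> = n"
  using length_finite_permutations_of_set by fastforce

lemma bij_betw_lehmer_code: "bij_betw lehmer_code (perms n) (codes n)"
proof (rule bij_betw_perms_codes)
  show "inj_on lehmer_code (perms n)"
    by (rule inj_onI, rule lehmer_code_inj) (simp_all add: permutations_of_set_def)
  show "lehmer_code ` perms n \<subseteq> codes n"
    using lehmer_code_in_codes perms_length by fastforce
qed


section \<open>Descents and the major code\<close>

definition descents :: "nat list \<Rightarrow> nat set" where
  "descents w = {i. 1 \<le> i \<and> i < length w \<and> w ! (i - 1) > w ! i}"

lemma maj_eq_sum_descents: "maj w = \<Sum> (descents w)"
  by (simp add: maj_def descents_def)

lemma descents_subset: "descents w \<subseteq> {1..<length w}"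
  by (auto simp: descents_def)

lemma finite_descents: "finite (descents w)"
  using descents_subset finite_subset by blast

lemma maj_Nil [simp]: "maj [] = 0"
  by (simp add: maj_def)

text \<open>The only possible new descent is at position \<open>length w\<close>. This is the
  recursion that a Foata step has to match.\<close>

lemma maj_snoc:
  "maj (w @ [a]) = maj w + (if w \<noteq> [] \<and> a < last w then length w else 0)"
proof -
  have "descents (w @ [a]) = descents w \<union> (if w \<noteq> [] \<and> a < last w then {length w} else {})"
    by (cases w rule: rev_cases) (auto simp: descents_def nth_append less_Suc_eq Suc_le_eq)
  moreover have "length w \<notin> descents w"
    by (simp add: descents_def)
  ultimately show ?thesis
    by (simp add: maj_eq_sum_descents finite_descents)
qed

text \<open>Standardizing preserves the order of the letters, hence the descents; \<open>del\<close>
  can therefore be replaced by plain filtering.\<close>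

lemma maj_standardize: "maj (standardize w) = maj w"
proof -
  have less: "card {y \<in> set w. y \<le> u} < card {y \<in> set w. y \<le> v} \<longleftrightarrow> u < v"
    if "u \<in> set w" "v \<in> set w" for u v
  proof
    show "card {y \<in> set w. y \<le> u} < card {y \<in> set w. y \<le> v}" if "u < v"
      proof (rule psubset_card_mono)
      show "{y \<in> set w. y \<le> u} \<subset> {y \<in> set w. y \<le> v}"
        using that \<open>v \<in> set w\<close> leD by (auto simp: set_eq_iff psubset_eq)
    qed simp
    have "card {y \<in> set w. y \<le> v} \<le> card {y \<in> set w. y \<le> u}" if "v \<le> u"
      by (rule card_mono) (use that in auto)
    then show "card {y \<in> set w. y \<le> u} < card {y \<in> set w. y \<le> v} \<Longrightarrow> u < v"
      by (meson linorder_not_less)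
  qed
  have "descents (standardize w) = descents w"
    by (auto simp: descents_def standardize_def less)
  then show ?thesis
    by (simp add: maj_eq_sum_descents)
qed

text \<open>
  The amount by which \<open>maj\<close> grows when a new smallest letter is inserted behind the first \<open>p\<close>
  letters of a word with descent set \<open>D\<close>.
\<close>

definition insertion_gain :: "nat set \<Rightarrow> nat \<Rightarrow> nat" where
  "insertion_gain D p = (if p \<in> D then 0 else p) + card {i \<in> D. p < i}"

text \<open>Descents before position \<open>length u\<close> stay, that position becomes a descent
  unless \<open>u\<close> is empty, the next one is none, and later descents move one place to the
  right.\<close>

lemma maj_insert_min:
  assumes "\<And>x. x \<in> set (u @ v) \<Longrightarrow> a < x"
  shows "maj (u @ a # v) = maj (u @ v) + insertion_gain (descents (u @ v)) (length u)"
proof -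
  let ?p = "length u" and ?D = "descents (u @ v)"
  let ?L = "{i \<in> ?D. i < ?p}" and ?R = "{i \<in> ?D. ?p < i}"
  have fin: "finite ?L" "finite ?R"
    using finite_descents by auto
  have mem: "i \<in> descents (u @ a # v) \<longleftrightarrow> i \<in> ?L \<union> {?p} - {0} \<union> Suc ` ?R" for i
  proof -
    consider "i < ?p" | "i = ?p" | "i = Suc ?p" | j where "i = Suc j" "?p < j"
      by (metis Suc_lessI less_Suc_eq_0_disj linorder_neqE_nat not_less0 Suc_less_eq2)
    then show ?thesis
    proof cases
      case 1
      then show ?thesis
        by (auto simp: descents_def nth_append)
    next
      case 2
      then show ?thesis
        using assms by (cases u rule: rev_cases) (auto simp: descents_def nth_append)
    next
      case 3
      then have "i \<notin> descents (u @ a # v)"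
        using assms[of "v ! 0"] by (auto simp: descents_def nth_append)
      with 3 show ?thesis
        by auto
    next
      case (4 j)
      then obtain k where k: "j = Suc ?p + k"
        by (metis Suc_leI le_Suc_ex)
      have "i \<in> descents (u @ a # v) \<longleftrightarrow> j \<in> ?D"
        using 4 by (auto simp: descents_def nth_append k)
      with 4 show ?thesis
        by auto
    qed
  qed
  then have "descents (u @ a # v) = (?L \<union> {?p}) - {0} \<union> Suc ` ?R"
    by blast
  then have "maj (u @ a # v) = \<Sum> ((?L \<union> {?p}) - {0} \<union> Suc ` ?R)"
    by (simp add: maj_eq_sum_descents)
  also have "\<dots> = \<Sum> ((?L \<union> {?p}) - {0}) + \<Sum> (Suc ` ?R)"
    by (rule sum.union_disjoint) (use fin in auto)
  \<comment> \<open>0 was excluded because an empty \<open>u\<close> creates no descent; putting it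
    back adds nothing to the sum.\<close>
  also have "\<Sum> ((?L \<union> {?p}) - {0}) = \<Sum> (?L \<union> {?p})"
    by (rule sum.mono_neutral_left) (use fin in auto)
  also have "\<dots> = \<Sum> ?L + ?p"
    using fin by simp
  also have "\<Sum> (Suc ` ?R) = \<Sum> ?R + card ?R"
    by (simp add: sum.reindex sum_Suc)
  finally have *: "maj (u @ a # v) = \<Sum> ?L + ?p + (\<Sum> ?R + card ?R)" .
  have "?D = ?L \<union> ?R \<union> (if ?p \<in> ?D then {?p} else {})"
    using linorder_less_linear by (auto split: if_splits)
  then have "maj (u @ v) = \<Sum> (?L \<union> ?R \<union> (if ?p \<in> ?D then {?p} else {}))"
    by (simp only: maj_eq_sum_descents)
  also have "\<dots> = \<Sum> ?L + \<Sum> ?R + (if ?p \<in> ?D then ?p else 0)"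
    by (subst sum.union_disjoint, use fin in auto)+
  finally show ?thesis
    using * by (simp add: insertion_gain_def)
qed

text \<open>If \<open>q\<close> is a descent, it is counted at \<open>p\<close> but not at
  \<open>q\<close>, so the gain at \<open>p\<close> is larger. Otherwise at most
  \<open>q - p - 1\<close> descents lie between them, which cannot make up for the difference
  \<open>q - p\<close>, so the gain at \<open>q\<close> is larger.\<close>

lemma insertion_gain_neq:
  assumes "finite D" "0 \<notin> D" "p < q"
  shows "insertion_gain D p \<noteq> insertion_gain D q"
proof (cases "q \<in> D")
  case True
  have "card {i \<in> D. q < i} < card {i \<in> D. p < i}"
    by (rule psubset_card_mono) (use assms True in auto)
  then show ?thesis
    using True by (simp add: insertion_gain_def)
next
  case False
  have "{i \<in> D. p < i} \<subseteq> {p<..<q} \<union> {i \<in> D. q < i}"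
    using False by (auto simp: not_less_iff_gr_or_eq)
  then have "card {i \<in> D. p < i} \<le> card ({p<..<q} \<union> {i \<in> D. q < i})"
    by (rule card_mono[rotated]) (use assms in auto)
  also have "\<dots> \<le> card {p<..<q} + card {i \<in> D. q < i}"
    by (rule card_Un_le)
  finally have "card {i \<in> D. p < i} + Suc p \<le> q + card {i \<in> D. q < i}"
    using assms(3) by simp
  then show ?thesis
    using False by (auto simp: insertion_gain_def)
qed

text \<open>For \<open>p < m\<close> at most \<open>m - p - 1\<close> descents exceed
  \<open>p\<close>. With \<open>m\<close> the length of the word this bounds the entries of the
  major code.\<close>

lemma insertion_gain_le:
  assumes "D \<subseteq> {1..<m}" "p \<le> m"
  shows "insertion_gain D p \<le> m"
proof -
  have "card {i \<in> D. p < i} \<le> card {p<..<m}"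
    by (rule card_mono) (use assms in auto)
  with assms(2) have "card {i \<in> D. p < i} + p \<le> m"
    by (cases "p = m") auto
  then show ?thesis
    by (auto simp: insertion_gain_def)
qed

lemma insert_min_inj:
  assumes "u @ v = u' @ v'" "\<And>x. x \<in> set (u @ v) \<Longrightarrow> a < x"
    "maj (u @ a # v) = maj (u' @ a # v')"
  shows "u @ a # v = u' @ a # v'"
proof -
  have "insertion_gain (descents (u @ v)) (length u) = insertion_gain (descents (u @ v)) (length u')"
    using assms maj_insert_min[of u v a] maj_insert_min[of u' v' a] by simp
  moreover have "0 \<notin> descents (u @ v)"
    by (simp add: descents_def)
  ultimately have "length u = length u'"
    using insertion_gain_neq[OF finite_descents] by (metis linorder_neqE_nat)
  with assms(1) show ?thesis
    by simp
qed

section \<open>The major code as a record of insertions of successively smaller letters\<close>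

lemma filter_ge_split:
  assumes "\<sigma> \<in> perms n" "1 \<le> i" "i \<le> n"
  obtains u v where "filter (\<lambda>x. i \<le> x) \<sigma> = u @ i # v" "filter (\<lambda>x. Suc i \<le> x) \<sigma> = u @ v"
    "\<And>x. x \<in> set (u @ v) \<Longrightarrow> i < x" "length (u @ v) = n - i"
proof -
  from assms have \<sigma>: "set \<sigma> = {1..n}" "distinct \<sigma>"
    by (auto dest: permutations_of_setD)
  with assms have "i \<in> set \<sigma>"
    by simp
  then obtain s t where st: "\<sigma> = s @ i # t"
    by (meson split_list)
  let ?f = "filter (\<lambda>x. Suc i \<le> x)"
  have "filter (\<lambda>x. i \<le> x) s = ?f s" "filter (\<lambda>x. i \<le> x) t = ?f t"
    using \<sigma>(2) st by (auto intro!: filter_cong simp: Suc_le_eq order.order_iff_strict)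
  then have "filter (\<lambda>x. i \<le> x) \<sigma> = ?f s @ i # ?f t"
    by (simp add: st)
  moreover have f: "?f \<sigma> = ?f s @ ?f t"
    by (simp add: st)
  moreover have "length (?f \<sigma>) = n - i"
  proof -
    have "set (?f \<sigma>) = {Suc i..n}"
      using \<sigma> by auto
    then show ?thesis
      using distinct_card[of "?f \<sigma>"] \<sigma>(2) by simp
  qed
  ultimately show ?thesis
    by (intro that[of "?f s" "?f t"]) (auto simp: Suc_le_eq)
qed

text \<open>List index \<open>i\<close> holds the code entry numbered \<open>i + 1\<close>, hence
  the shifted thresholds.\<close>

lemma major_code_nth:
  assumes "i < length \<sigma>"
  shows "major_code \<sigma> ! i =
    int (maj (filter (\<lambda>x. Suc i \<le> x) \<sigma>)) - int (maj (filter (\<lambda>x. Suc (Suc i) \<le> x) \<sigma>))"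
proof -
  have "[1..<length \<sigma> + 1] ! i = Suc i"
    using assms by (subst nth_upt) auto
  then show ?thesis
    using assms by (simp add: major_code_def del_def maj_standardize del: upt_Suc)
qed

text \<open>The entry is the gain from inserting \<open>Suc i\<close> into a word of
  \<open>n - Suc i\<close> larger letters.\<close>

lemma major_code_nth_bounds:
  assumes "\<sigma> \<in> perms n" "i < n"
  shows "0 \<le> major_code \<sigma> ! i" "major_code \<sigma> ! i < int (n - i)"
proof -
  obtain u v where uv: "filter (\<lambda>x. Suc i \<le> x) \<sigma> = u @ Suc i # v"
    "filter (\<lambda>x. Suc (Suc i) \<le> x) \<sigma> = u @ v"
    "\<And>x. x \<in> set (u @ v) \<Longrightarrow> Suc i < x" "length (u @ v) = n - Suc i"
    using filter_ge_split[of \<sigma> n "Suc i"] assms by auto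
  have "major_code \<sigma> ! i = int (insertion_gain (descents (u @ v)) (length u))"
    using assms perms_length maj_insert_min[OF uv(3)] by (simp add: major_code_nth uv(1,2))
  moreover have "insertion_gain (descents (u @ v)) (length u) \<le> n - Suc i"
    using insertion_gain_le[OF descents_subset, of "length u" "u @ v"] uv(4) by simp
  ultimately show "0 \<le> major_code \<sigma> ! i" "major_code \<sigma> ! i < int (n - i)"
    using assms(2) by auto
qed

lemma length_major_code [simp]: "length (major_code \<sigma>) = length \<sigma>"
  by (simp add: major_code_def del: upt_Suc)

text \<open>Decoding runs from the largest letter down: once the order of the letters above
  \<open>Suc i\<close> is known, the code entry fixes \<open>maj\<close> after inserting
  \<open>Suc i\<close>, and thereby the place of insertion.\<close>

lemma major_code_inj:
  assumes "\<sigma> \<in> perms n" "\<tau> \<in> perms n" "major_code \<sigma> = major_code \<tau>"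
  shows "\<sigma> = \<tau>"
proof -
  note len = perms_length[OF assms(1)] perms_length[OF assms(2)]
  have sets: "set \<sigma> = {1..n}" "set \<tau> = {1..n}"
    using assms by (auto dest: permutations_of_setD)
  have "filter (\<lambda>x. Suc i \<le> x) \<sigma> = filter (\<lambda>x. Suc i \<le> x) \<tau>" if "i \<le> n" for i
    using that
  proof (induction i rule: inc_induct)
    case base
    have "filter (\<lambda>x. Suc n \<le> x) \<sigma> = []" "filter (\<lambda>x. Suc n \<le> x) \<tau> = []"
      using sets by (auto simp: filter_empty_conv)
    then show ?case
      by simp
  next
    case (step i)
    obtain u v where uv: "filter (\<lambda>x. Suc i \<le> x) \<sigma> = u @ Suc i # v"
      "filter (\<lambda>x. Suc (Suc i) \<le> x) \<sigma> = u @ v" "\<And>x. x \<in> set (u @ v) \<Longrightarrow> Suc i < x"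
      using filter_ge_split[OF assms(1), of "Suc i"] step.hyps by (metis Suc_leI le_add1 plus_1_eq_Suc)
    obtain u' v' where uv': "filter (\<lambda>x. Suc i \<le> x) \<tau> = u' @ Suc i # v'"
      "filter (\<lambda>x. Suc (Suc i) \<le> x) \<tau> = u' @ v'"
      using filter_ge_split[OF assms(2), of "Suc i"] step.hyps by (metis Suc_leI le_add1 plus_1_eq_Suc)
    have eq: "u @ v = u' @ v'"
      using step.IH by (simp only: uv uv')
    have "major_code \<sigma> ! i = major_code \<tau> ! i"
      using assms(3) by simp
    then have "maj (u @ Suc i # v) = maj (u' @ Suc i # v')"
      using step.hyps len by (simp add: major_code_nth uv(1,2) uv' eq)
    with eq uv(3) show ?case
      unfolding uv(1) uv'(1) by (intro insert_min_inj) auto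
  qed
  from this[of 0] have "filter (\<lambda>x. Suc 0 \<le> x) \<sigma> = filter (\<lambda>x. Suc 0 \<le> x) \<tau>"
    by simp
  moreover have "filter (\<lambda>x. Suc 0 \<le> x) \<sigma> = \<sigma>" "filter (\<lambda>x. Suc 0 \<le> x) \<tau> = \<tau>"
    using sets by (auto simp: filter_id_conv)
  ultimately show ?thesis
    by simp
qed

text \<open>Mediates between the integer-valued code and the natural numbers in
  \<open>codes\<close>; nothing is lost because the entries are nonnegative.\<close>

lemma map_nat_major_code:
  assumes "\<sigma> \<in> perms n"
  shows "map int (map nat (major_code \<sigma>)) = major_code \<sigma>"
proof (rule nth_equalityI)
  fix i assume "i < length (map int (map nat (major_code \<sigma>)))"
  then show "map int (map nat (major_code \<sigma>)) ! i = major_code \<sigma> ! i"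
    using major_code_nth_bounds(1)[OF assms] perms_length[OF assms] by simp
qed simp

lemma bij_betw_nat_major_code: "bij_betw (\<lambda>\<sigma>. map nat (major_code \<sigma>)) (perms n) (codes n)"
proof (rule bij_betw_perms_codes)
  show "inj_on (\<lambda>\<sigma>. map nat (major_code \<sigma>)) (perms n)"
    by (intro inj_onI) (metis major_code_inj map_nat_major_code)
  show "(\<lambda>\<sigma>. map nat (major_code \<sigma>)) ` perms n \<subseteq> codes n"
  proof (intro image_subsetI in_codesI)
    fix \<sigma> i assume \<sigma>: "\<sigma> \<in> perms n"
    then show "length (map nat (major_code \<sigma>)) = n"
      by (simp add: perms_length)
    assume "i < n"
    then show "map nat (major_code \<sigma>) ! i < n - i"
      using major_code_nth_bounds[OF \<sigma>] perms_length[OF \<sigma>] by (simp add: nat_less_iff)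
  qed
qed

lemma sum_list_major_code:
  assumes "\<sigma> \<in> perms n"
  shows "sum_list (major_code \<sigma>) = int (maj \<sigma>)"
proof -
  let ?m = "\<lambda>i. int (maj (filter (\<lambda>x. Suc i \<le> x) \<sigma>))"
  have len: "length \<sigma> = n" and set: "set \<sigma> = {1..n}"
    using assms perms_length by (auto dest: permutations_of_setD)
  have "sum_list (major_code \<sigma>) = (\<Sum>i<n. major_code \<sigma> ! i)"
    by (simp add: sum_list_sum_nth len atLeast0LessThan)
  also have "\<dots> = (\<Sum>i<n. ?m i - ?m (Suc i))"
    by (rule sum.cong) (simp_all add: major_code_nth len)
  also have "\<dots> = ?m 0 - ?m n"
    by (rule sum_lessThan_telescope')
  also have "filter (\<lambda>x. Suc 0 \<le> x) \<sigma> = \<sigma>"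
    using set by (auto simp: filter_id_conv)
  also have "filter (\<lambda>x. Suc n \<le> x) \<sigma> = []"
    using set by (auto simp: filter_empty_conv)
  finally show ?thesis
    by simp
qed

text \<open>Justifies the definite description: the major code is onto \<open>codes n\<close>, which
  gives existence, and injective, which gives uniqueness.\<close>

lemma lehmer_to_major_eq:
  assumes "\<sigma> \<in> perms n"
  shows "lehmer_to_major \<sigma> \<in> perms n" "map nat (major_code (lehmer_to_major \<sigma>)) = lehmer_code \<sigma>"
proof -
  have len: "length \<sigma> = n"
    by (rule perms_length[OF assms])
  have "lehmer_code \<sigma> \<in> codes n"
    using lehmer_code_in_codes[of \<sigma>] len by simp
  then obtain \<tau> where \<tau>: "\<tau> \<in> perms n" "map nat (major_code \<tau>) = lehmer_code \<sigma>"
    using bij_betw_nat_major_code[of n] unfolding bij_betw_def by (metis (no_types, lifting) imageE)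
  then have "major_code \<tau> = map int (lehmer_code \<sigma>)"
    using map_nat_major_code by metis
  with \<tau> have "lehmer_to_major \<sigma> = \<tau>"
    unfolding lehmer_to_major_def len by (intro the_equality) (auto intro: major_code_inj)
  with \<tau> show "lehmer_to_major \<sigma> \<in> perms n" "map nat (major_code (lehmer_to_major \<sigma>)) = lehmer_code \<sigma>"
    by auto
qed

lemma bij_betw_lehmer_to_major: "bij_betw lehmer_to_major (perms n) (perms n)"
proof -
  have "inj_on lehmer_to_major (perms n)"
    using bij_betw_lehmer_code[of n] lehmer_to_major_eq(2)
    by (intro inj_onI) (metis bij_betw_def inj_onD)
  moreover have "lehmer_to_major ` perms n \<subseteq> perms n"
    using lehmer_to_major_eq(1) by auto
  ultimately show ?thesis
    by (simp add: bij_betw_def endo_inj_surj)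
qed

lemma maj_lehmer_to_major:
  assumes "\<sigma> \<in> perms n"
  shows "maj (lehmer_to_major \<sigma>) = inversions \<sigma>"
proof -
  let ?\<tau> = "lehmer_to_major \<sigma>"
  note \<tau> = lehmer_to_major_eq[OF assms]
  have "int (inversions \<sigma>) = sum_list (map int (lehmer_code \<sigma>))"
    by (simp add: inversions_eq_sum_lehmer_code sum_list_of_nat)
  also have "map int (lehmer_code \<sigma>) = major_code ?\<tau>"
    using \<tau> map_nat_major_code by metis
  also have "sum_list \<dots> = int (maj ?\<tau>)"
    by (rule sum_list_major_code[OF \<tau>(1)])
  finally show ?thesis
    by simp
qed


section \<open>The Foata bijection\<close>

text \<open>Abstracts from the comparison with the new letter, so that both cases of a Foata step
  share one theory. Letters satisfying \<open>P\<close> are called marked below.\<close>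

definition shift_blocks :: "('a \<Rightarrow> bool) \<Rightarrow> 'a list \<Rightarrow> 'a list" where
  "shift_blocks P w = concat (map shift_right (blocks P w))"

lemma foata_step_eq:
  "foata_step \<tau> a = shift_blocks (\<lambda>t. if a > last \<tau> then a > t else a < t) \<tau> @ [a]"
  by (simp add: foata_step_def shift_blocks_def)

lemma blocks_append_Cons:
  "\<forall>x\<in>set u. \<not> P x \<Longrightarrow> P p \<Longrightarrow> blocks P (u @ p # v) = (u @ [p]) # blocks P v"
  by (induction u) auto

lemma shift_blocks_Nil [simp]: "shift_blocks P [] = []"
  by (simp add: shift_blocks_def)

lemma shift_blocks_append_Cons:
  "\<forall>x\<in>set u. \<not> P x \<Longrightarrow> P p \<Longrightarrow> shift_blocks P (u @ p # v) = p # u @ shift_blocks P v"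
  by (simp add: shift_blocks_def blocks_append_Cons shift_right_def)

text \<open>If the last letter is marked, every block is an unmarked run closed by one marked
  letter, with no incomplete block at the end; the induction peels off the first block.\<close>

lemma block_induct [consumes 1, case_names Nil block]:
  assumes "w = [] \<or> P (last w)"
    and "Q []"
    and "\<And>u p v. \<forall>x\<in>set u. \<not> P x \<Longrightarrow> P p \<Longrightarrow> v = [] \<or> P (last v) \<Longrightarrow> Q v \<Longrightarrow> Q (u @ p # v)"
  shows "Q w"
  using assms(1)
proof (induction w rule: length_induct)
  case (1 w)
  show ?case
  proof (cases "w = []")
    case False
    with 1 have "\<exists>x\<in>set w. P x"
      by (auto intro: last_in_set)
    then obtain u p v where w: "w = u @ p # v" "P p" "\<forall>x\<in>set u. \<not> P x"
      by (metis split_list_first_prop)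
    have v: "v = [] \<or> P (last v)"
      using 1(2) w(1) by (cases "v = []") auto
    moreover have "Q v"
      using 1(1)[rule_format, of v] v w(1) by simp
    ultimately show ?thesis
      using w assms(3) by blast
  qed (use assms(2) in simp)
qed

lemma mset_shift_blocks:
  assumes "w = [] \<or> P (last w)"
  shows "mset (shift_blocks P w) = mset w"
  using assms by (induction rule: block_induct[where P = P]) (auto simp: shift_blocks_append_Cons)

text \<open>The shift moves the closing letter of a block to its front, so block boundaries stay
  visible as marked letters.\<close>

lemma hd_shift_blocks:
  assumes "w = [] \<or> P (last w)" "w \<noteq> []"
  shows "shift_blocks P w \<noteq> [] \<and> P (hd (shift_blocks P w))"
  using assms by (induction rule: block_induct[where P = P]) (auto simp: shift_blocks_append_Cons)

lemma shift_blocks_inj: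
  assumes "w = [] \<or> P (last w)" "w' = [] \<or> P (last w')"
    and "shift_blocks P w = shift_blocks P w'"
  shows "w = w'"
  using assms
proof (induction arbitrary: w' rule: block_induct[where P = P])
  case Nil
  then show ?case
    using hd_shift_blocks[of w' P] by fastforce
next
  case (block u p v)
  \<comment> \<open>The run \<open>s\<close> can be read off, since the shifted remainder is empty
    or starts with a marked letter.\<close>
  have tw: "takeWhile (\<lambda>x. \<not> P x) (s @ shift_blocks P t) = s"
    if s: "\<forall>x\<in>set s. \<not> P x" and t: "t = [] \<or> P (last t)" for s t
  proof (cases "t = []")
    case False
    then obtain y ys where "shift_blocks P t = y # ys" "P y"
      using hd_shift_blocks[of t P] t by (cases "shift_blocks P t") auto
    with s show ?thesis
      by (simp add: takeWhile_append)
  qed (use s in \<open>simp add: takeWhile_eq_all_conv\<close>)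
  have "w' \<noteq> []"
    using block.prems block.hyps by (auto simp: shift_blocks_append_Cons)
  with block.prems(1) have "\<exists>x\<in>set w'. P x"
    by (auto intro: last_in_set)
  then obtain u' p' v' where w': "w' = u' @ p' # v'" "P p'" "\<forall>x\<in>set u'. \<not> P x"
    by (metis split_list_first_prop)
  have v': "v' = [] \<or> P (last v')"
    using block.prems(1) w'(1) by (cases "v' = []") auto
  have eq: "p = p'" "u @ shift_blocks P v = u' @ shift_blocks P v'"
    using block.prems(2) block.hyps w' by (simp_all add: shift_blocks_append_Cons)
  have "u = u'"
    using tw[OF block.hyps(1,3)] tw[OF w'(3) v'] eq(2) by metis
  with eq block.IH[OF v'] show ?case
    by (simp add: w')
qed

section \<open>Effect of block shifts on the number of inversions\<close>

lemma inversions_append: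
  "inversions (u @ v) =
    inversions u + inversions v + (\<Sum>x\<leftarrow>u. length (filter (\<lambda>y. y < x) v))"
  by (induction u) auto

text \<open>Only pairs of \<open>p\<close> with a letter of \<open>u\<close> change their order. The
  additive form avoids truncated subtraction.\<close>

lemma inversions_move_front:
  "inversions (p # u @ v) + length (filter (\<lambda>x. p < x) u) =
    inversions (u @ p # v) + length (filter (\<lambda>x. x < p) u)"
  by (induction u) auto

lemma length_filter_mset_cong: "mset v = mset v' \<Longrightarrow> length (filter Q v) = length (filter Q v')"
  by (metis mset_filter size_mset)

text \<open>Inversions between the two factors depend on the second one only through its multiset of
  letters.\<close>

lemma inversions_append_mset_cong:
  assumes "mset v = mset v'"
  shows "inversions (u @ v) + inversions v' = inversions (u @ v') + inversions v"
  using length_filter_mset_cong[OF assms] by (simp add: inversions_append)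

lemma inversions_shift_block:
  assumes "\<forall>x\<in>set u. \<not> P x" "P p" "v = [] \<or> P (last v)"
  shows "inversions (shift_blocks P (u @ p # v)) + length (filter (\<lambda>x. p < x) u) + inversions v =
    inversions (u @ p # v) + length (filter (\<lambda>x. x < p) u) + inversions (shift_blocks P v)"
  using inversions_move_front[of p u v]
    inversions_append_mset_cong[OF mset_shift_blocks[of v P, OF assms(3)], of "p # u"]
  by (simp add: shift_blocks_append_Cons assms(1,2))

text \<open>In each block the letters of \<open>u\<close> exceed \<open>a\<close> and
  \<open>p\<close> is below it, so moving \<open>p\<close> to the front removes one inversion per
  letter of \<open>u\<close>. Over all blocks these are exactly the letters greater than
  \<open>a\<close>.\<close>

lemma inversions_shift_blocks_less:
  fixes a :: nat
  assumes "w = [] \<or> last w < a" "a \<notin> set w"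
  shows "inversions (shift_blocks (\<lambda>t. t < a) w) + length (filter (\<lambda>t. a < t) w) = inversions w"
  using assms
proof (induction rule: block_induct[where P = "\<lambda>t. t < a"])
  case (block u p v)
  have "a < x" if "x \<in> set u" for x
    using block.hyps(1) block.prems that by (metis UnI1 linorder_neqE_nat set_append)
  with block.hyps(2) have "filter (\<lambda>x. p < x) u = u" "filter (\<lambda>x. x < p) u = []" "filter (\<lambda>t. a < t) u = u"
    by (force simp: filter_id_conv filter_empty_conv)+
  then show ?case
    using inversions_shift_block[of u "\<lambda>t. t < a" p v] block by simp
qed simp

text \<open>Here each move of \<open>p\<close> creates one inversion per letter of \<open>u\<close>,
  and over all blocks these are exactly the letters smaller than \<open>a\<close>.\<close>

lemma inversions_shift_blocks_greater:
  fixes a :: nat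
  assumes "w = [] \<or> a < last w" "a \<notin> set w"
  shows "inversions (shift_blocks (\<lambda>t. a < t) w) + length (filter (\<lambda>t. a < t) w) =
    inversions w + length w"
  using assms
proof (induction rule: block_induct[where P = "\<lambda>t. a < t"])
  case (block u p v)
  have "filter (\<lambda>x. p < x) u = []" "filter (\<lambda>x. x < p) u = u" "filter (\<lambda>t. a < t) u = []"
    using block.hyps block.prems by (auto simp: filter_id_conv filter_empty_conv)
  then show ?case
    using inversions_shift_block[of u "\<lambda>t. a < t" p v] block by simp
qed simp

lemma inversions_snoc:
  "inversions (w @ [a]) = inversions w + length (filter (\<lambda>t. a < t) w)"
  by (induction w) auto

text \<open>The last letter is always marked, as the marking is chosen by comparing it with
  \<open>a\<close>; this makes \<open>block_induct\<close> applicable.\<close>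

lemma last_foata_step_pred:
  fixes a :: nat
  shows "a \<notin> set \<tau> \<Longrightarrow> \<tau> = [] \<or> (if a > last \<tau> then a > last \<tau> else a < last \<tau>)"
  using last_in_set[of \<tau>] by (cases "last \<tau>" a rule: linorder_cases) auto

lemma mset_foata_step:
  assumes "a \<notin> set \<tau>"
  shows "mset (foata_step \<tau> a) = add_mset a (mset \<tau>)"
  unfolding foata_step_eq
  by (subst mset_append, subst mset_shift_blocks) (use last_foata_step_pred[OF assms] in simp_all)

text \<open>Let g be the number of letters greater than \<open>a\<close>. The shift changes the
  inversion number by -g or by \<open>length \<tau>\<close> - g, and appending \<open>a\<close> adds
  g, leaving the increment of \<open>maj_snoc\<close>.\<close>

lemma inversions_foata_step:
  assumes "a \<notin> set \<tau>"
  shows "inversions (foata_step \<tau> a) =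
    inversions \<tau> + (if \<tau> \<noteq> [] \<and> a < last \<tau> then length \<tau> else 0)"
proof (cases "\<tau> = []")
  case False
  let ?P = "\<lambda>t. if a > last \<tau> then a > t else a < t"
  have "mset (shift_blocks ?P \<tau>) = mset \<tau>"
    by (rule mset_shift_blocks) (use last_foata_step_pred[OF assms] in simp_all)
  then have len: "length (filter (\<lambda>t. a < t) (shift_blocks ?P \<tau>)) = length (filter (\<lambda>t. a < t) \<tau>)"
    by (rule length_filter_mset_cong)
  have "a \<noteq> last \<tau>"
    using False assms last_in_set by metis
  then consider "last \<tau> < a" | "a < last \<tau>"
    by linarith
  then show ?thesis
  proof cases
    case 1
    then show ?thesis
      using len inversions_shift_blocks_less[of \<tau> a] assms
      by (simp add: foata_step_eq inversions_snoc)
  next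
    case 2
    then have "?P = (\<lambda>t. a < t)"
      by auto
    then show ?thesis
      using 2 False len inversions_shift_blocks_greater[of \<tau> a] assms
      by (simp add: foata_step_eq inversions_snoc)
  qed
qed (simp add: foata_step_eq)

text \<open>The first letter of a shifted word lies on the same side of \<open>a\<close> as the last letter of \<open>\<tau>\<close>,
  so it reveals which of the two cases of the Foata step was applied.\<close>

lemma foata_step_inj:
  assumes "foata_step \<tau> a = foata_step \<tau>' a'" "a \<notin> set \<tau>" "a' \<notin> set \<tau>'"
  shows "\<tau> = \<tau>' \<and> a = a'"
proof -
  let ?P = "\<lambda>\<tau> t. if a > last \<tau> then a > t else a < t"
  have a: "a' = a"
    using assms(1) by (simp add: foata_step_eq)
  have eq: "shift_blocks (?P \<tau>) \<tau> = shift_blocks (?P \<tau>') \<tau>'"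
    using assms(1) unfolding a foata_step_eq append1_eq_conv by (rule conjunct1)
  have l: "\<tau> = [] \<or> ?P \<tau> (last \<tau>)"
    using last_foata_step_pred[OF assms(2)] .
  have l': "\<tau>' = [] \<or> ?P \<tau>' (last \<tau>')"
    using last_foata_step_pred[OF assms(3)] unfolding a .
  have mset: "mset \<tau> = mset \<tau>'"
    using mset_shift_blocks[of \<tau> "?P \<tau>", OF l] mset_shift_blocks[of \<tau>' "?P \<tau>'", OF l'] eq by simp
  show ?thesis
  proof (cases "\<tau> = []")
    case False
    with mset have "\<tau>' \<noteq> []"
      by auto
    then have "?P \<tau>' (hd (shift_blocks (?P \<tau>) \<tau>))"
      unfolding eq by (rule hd_shift_blocks[of \<tau>' "?P \<tau>'", OF l', THEN conjunct2])
    moreover have "?P \<tau> (hd (shift_blocks (?P \<tau>) \<tau>))"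
      using hd_shift_blocks[of \<tau> "?P \<tau>", OF l False] by (rule conjunct2)
    ultimately have "a > last \<tau> \<longleftrightarrow> a > last \<tau>'"
      by (auto split: if_splits)
    then show ?thesis
      using shift_blocks_inj[of \<tau> "?P \<tau>" \<tau>'] l l' eq a by simp
  qed (use mset a in auto)
qed

section \<open>Iterating the Foata steps\<close>

lemma foata_Nil [simp]: "foata [] = []"
  by (simp add: foata_def)

lemma foata_snoc [simp]: "foata (\<sigma> @ [a]) = foata_step (foata \<sigma>) a"
  by (simp add: foata_def)

lemma mset_foata: "distinct \<sigma> \<Longrightarrow> mset (foata \<sigma>) = mset \<sigma>"
proof (induction \<sigma> rule: rev_induct)
  case (snoc a \<sigma>)
  then have "set (foata \<sigma>) = set \<sigma>"
    by (auto dest: mset_eq_setD)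
  with snoc show ?case
    by (simp add: mset_foata_step)
qed simp

lemma set_foata: "distinct \<sigma> \<Longrightarrow> set (foata \<sigma>) = set \<sigma>"
  using mset_foata mset_eq_setD by blast

text \<open>Turns the case distinction of the Foata step into the descent test for the original
  word. For the empty word both sides are \<open>last []\<close>.\<close>

lemma last_foata: "last (foata \<sigma>) = last \<sigma>"
  by (cases \<sigma> rule: rev_cases) (auto simp: foata_step_eq)

lemma inversions_foata: "distinct \<sigma> \<Longrightarrow> inversions (foata \<sigma>) = maj \<sigma>"
proof (induction \<sigma> rule: rev_induct)
  case (snoc a \<sigma>)
  have a: "a \<notin> set (foata \<sigma>)"
    using snoc.prems set_foata[of \<sigma>] by simp
  have len: "length (foata \<sigma>) = length \<sigma>"
    using snoc.prems by (intro mset_eq_length mset_foata) simp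
  then have "foata \<sigma> = [] \<longleftrightarrow> \<sigma> = []"
    by (metis length_0_conv)
  with a len snoc show ?case
    by (simp add: inversions_foata_step maj_snoc last_foata)
qed simp

text \<open>The steps are undone one at a time from the end.\<close>

lemma foata_inj:
  "distinct \<sigma> \<Longrightarrow> distinct \<tau> \<Longrightarrow> foata \<sigma> = foata \<tau> \<Longrightarrow> \<sigma> = \<tau>"
proof (induction \<sigma> arbitrary: \<tau> rule: rev_induct)
  case Nil
  then show ?case
    using set_foata[of \<tau>] by simp
next
  case (snoc a \<sigma>)
  have "set \<tau> = set (\<sigma> @ [a])"
    using snoc.prems set_foata by metis
  then obtain \<tau>' b where \<tau>: "\<tau> = \<tau>' @ [b]"
    by (cases \<tau> rule: rev_cases) auto
  then have "foata \<sigma> = foata \<tau>' \<and> a = b"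
    using snoc.prems by (intro foata_step_inj) (auto simp: set_foata)
  with snoc \<tau> show ?case
    by simp
qed

lemma bij_betw_foata: "bij_betw foata (perms n) (perms n)"
proof -
  have "inj_on foata (perms n)"
    by (rule inj_onI, rule foata_inj) (auto dest: permutations_of_setD)
  moreover have "foata \<sigma> \<in> perms n" if "\<sigma> \<in> perms n" for \<sigma>
  proof -
    have "distinct \<sigma>" "set \<sigma> = {1..n}"
      using that by (auto dest: permutations_of_setD)
    then show ?thesis
      using mset_foata[of \<sigma>] set_foata[of \<sigma>]
      by (metis mset_eq_imp_distinct_iff permutations_of_setI)
  qed
  then have "foata ` perms n \<subseteq> perms n"
    by auto
  ultimately show ?thesis
    by (simp add: bij_betw_def endo_inj_surj)
qed


theorem theorem6p9:
  fixes n :: nat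
  assumes "n > 0"
  shows "mesic 0 (\<lambda>\<sigma>. real (maj \<sigma>) - real (inversions \<sigma>)) (perms n) lehmer_to_major
    \<and> mesic 0 (\<lambda>\<sigma>. real (maj \<sigma>) - real (inversions \<sigma>)) (perms n) (inv_into (perms n) lehmer_to_major)
    \<and> mesic 0 (\<lambda>\<sigma>. real (maj \<sigma>) - real (inversions \<sigma>)) (perms n) foata
    \<and> mesic 0 (\<lambda>\<sigma>. real (maj \<sigma>) - real (inversions \<sigma>)) (perms n) (inv_into (perms n) foata)"
proof -
  have M: "real (maj (lehmer_to_major \<sigma>)) = real (inversions \<sigma>)" if "\<sigma> \<in> perms n" for \<sigma>
    using maj_lehmer_to_major[OF that] by simp
  have F: "real (inversions (foata \<sigma>)) = real (maj \<sigma>)" if "\<sigma> \<in> perms n" for \<sigma>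
    using inversions_foata[of \<sigma>] permutations_of_setD(2)[OF that] by simp
  show ?thesis
  proof (intro conjI)
    show "mesic 0 (\<lambda>\<sigma>. real (maj \<sigma>) - real (inversions \<sigma>)) (perms n) lehmer_to_major"
      by (rule mesic_diff_if_exchanged) (use M bij_betw_lehmer_to_major in auto)
    show "mesic 0 (\<lambda>\<sigma>. real (maj \<sigma>) - real (inversions \<sigma>)) (perms n) (inv_into (perms n) lehmer_to_major)"
      by (rule mesic_diff_commute, rule mesic_inv_into_diff_if_exchanged)
        (use M bij_betw_lehmer_to_major in auto)
    show "mesic 0 (\<lambda>\<sigma>. real (maj \<sigma>) - real (inversions \<sigma>)) (perms n) foata"
      by (rule mesic_diff_commute, rule mesic_diff_if_exchanged) (use F bij_betw_foata in auto)
    show "mesic 0 (\<lambda>\<sigma>. real (maj \<sigma>) - real (inversions \<sigma>)) (perms n) (inv_into (perms n) foata)"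
      by (rule mesic_inv_into_diff_if_exchanged) (use F bij_betw_foata in auto)
  qed
qed

end
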